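(* The set $\mathcal{QT}$ endowed with the norm $\|\cdot\|_{\mathcal{QT}}$ is a Banach space.
   Context: $\mathbb T=\{z\in\mathbb C: |z|=1\}$ and $\mathbb Z^+$ is the set of positive integers. The Wiener class $\mathcal W$ is the set of functions $a(z)=\sum_{i\in\mathbb Z}a_iz^i:\mathbb T\to\mathbb C$ with $\|a\|_{\mathcal W}:=\sum_{i\in\mathbb Z}|a_i|<\infty$. For $a\in\mathcal W$, $T(a)=(t_{i,j})_{i,j\in\mathbb Z^+}$ is the semi-infinite Toeplitz matrix with $t_{i,j}=a_{j-i}$. $\mathcal F$ is the set of semi-infinite complex matrices $F=(f_{i,j})_{i,j\in\mathbb Z^+}$ with $\|F\|_{\mathcal F}:=\sum_{i,j\in\mathbb Z^+}|f_{i,j}|<\infty$. A quasi-Toeplitz matrix (QT-matrix) is a semi-infinite matrix of the form $A=T(a)+E$ with $a\in\mathcal W$ and $E\in\mathcal F$ (this decomposition is unique); $\mathcal{QT}$ is the set of all QT-matrices, a complex vector space under entrywise operations, and $\|T(a)+E\|_{\mathcal{QT}}:=\|a\|_{\mathcal W}+\|E\|_{\mathcal F}$. *)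

theory Defs
  imports "HOL-Analysis.Analysis" "HOL-Library.Function_Algebras"
begin

text \<open>The Banach space predicate lives on a subset of an ambient complex vector space, with scalar
  multiplication \<open>smul\<close>; the type class \<open>banach\<close> only provides real scalars on a whole type.\<close>

definition complex_normed_space_on ::
    "'v::ab_group_add set \<Rightarrow> (complex \<Rightarrow> 'v \<Rightarrow> 'v) \<Rightarrow> ('v \<Rightarrow> real) \<Rightarrow> bool" where
  "complex_normed_space_on V smul N \<longleftrightarrow>
     vector_space smul \<and> module.subspace smul V \<and>
     (\<forall>x\<in>V. 0 \<le> N x) \<and>
     (\<forall>x\<in>V. N x = 0 \<longleftrightarrow> x = 0) \<and>
     (\<forall>c. \<forall>x\<in>V. N (smul c x) = cmod c * N x) \<and>
     (\<forall>x\<in>V. \<forall>y\<in>V. N (x + y) \<le> N x + N y)"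

text \<open>The distance is cut off to 0 outside \<open>V\<close> only because \<^locale>\<open>Metric_space\<close> requires a distance
  that is nonnegative and symmetric on the whole type.\<close>

definition norm_dist_on :: "'v::ab_group_add set \<Rightarrow> ('v \<Rightarrow> real) \<Rightarrow> 'v \<Rightarrow> 'v \<Rightarrow> real" where
  "norm_dist_on V N x y = (if x \<in> V \<and> y \<in> V then N (x - y) else 0)"

definition complex_banach_space_on ::
    "'v::ab_group_add set \<Rightarrow> (complex \<Rightarrow> 'v \<Rightarrow> 'v) \<Rightarrow> ('v \<Rightarrow> real) \<Rightarrow> bool" where
  "complex_banach_space_on V smul N \<longleftrightarrow>
     complex_normed_space_on V smul N \<and>
     Metric_space V (norm_dist_on V N) \<and>
     Metric_space.mcomplete V (norm_dist_on V N)"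

abbreviation unit_circle :: "complex set" where
  "unit_circle \<equiv> sphere 0 1"

definition is_wiener_expansion :: "(complex \<Rightarrow> complex) \<Rightarrow> (int \<Rightarrow> complex) \<Rightarrow> bool" where
  "is_wiener_expansion a c \<longleftrightarrow>
     (\<lambda>i. cmod (c i)) summable_on UNIV \<and>
     (\<forall>z\<in>unit_circle. ((\<lambda>i. c i * z powi i) has_sum a z) UNIV)"

text \<open>Functions on the circle are represented as functions on the complex plane that take the value
  \<^const>\<open>undefined\<close> off the circle.\<close>

definition wiener :: "(complex \<Rightarrow> complex) set" where
  "wiener = {a \<in> extensional unit_circle. \<exists>c. is_wiener_expansion a c}"

definition wiener_coeff :: "(complex \<Rightarrow> complex) \<Rightarrow> int \<Rightarrow> complex" where
  "wiener_coeff a = (THE c. is_wiener_expansion a c)"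

definition wiener_norm :: "(complex \<Rightarrow> complex) \<Rightarrow> real" where
  "wiener_norm a = (\<Sum>\<^sub>\<infinity>i. cmod (wiener_coeff a i))"

text \<open>Rows and columns are numbered from 0: the entry \<open>A i j\<close> is the entry in position
  \<open>(i + 1, j + 1)\<close> in the numbering by positive integers. Addition and zero of matrices are the
  pointwise ones of \<^theory>\<open>HOL-Library.Function_Algebras\<close>.\<close>

type_synonym inf_matrix = "nat \<Rightarrow> nat \<Rightarrow> complex"

definition mat_scale :: "complex \<Rightarrow> inf_matrix \<Rightarrow> inf_matrix" where
  "mat_scale c A = (\<lambda>i j. c * A i j)"

definition toeplitz :: "(complex \<Rightarrow> complex) \<Rightarrow> inf_matrix" where
  "toeplitz a = (\<lambda>i j. wiener_coeff a (int j - int i))"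

definition summable_matrices :: "inf_matrix set" where
  "summable_matrices = {F. (\<lambda>(i, j). cmod (F i j)) summable_on UNIV}"

definition summable_matrix_norm :: "inf_matrix \<Rightarrow> real" where
  "summable_matrix_norm F = (\<Sum>\<^sub>\<infinity>(i, j). cmod (F i j))"

definition QT :: "inf_matrix set" where
  "QT = {toeplitz a + E | a E. a \<in> wiener \<and> E \<in> summable_matrices}"

definition QT_norm :: "inf_matrix \<Rightarrow> real" where
  "QT_norm A = (THE r. \<exists>a\<in>wiener. \<exists>E\<in>summable_matrices.
     A = toeplitz a + E \<and> r = wiener_norm a + summable_matrix_norm E)"

end

theory Submission
  imports Defs
begin

text \<open>Up to an isometry, the quasi-Toeplitz matrices are an \<open>\<ell>\<^sup>1\<close> space. A pair consisting of a
  coefficient family indexed by the integers and an absolutely summable matrix is the same thing as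
  one absolutely summable family on the disjoint union \<^typ>\<open>int + nat \<times> nat\<close>, and the sum of the
  two norms is the \<open>\<ell>\<^sup>1\<close> norm of that family. The map \<open>qt_matrix\<close> that sends such a family to the
  quasi-Toeplitz matrix it describes is linear, so completeness of \<open>\<ell>\<^sup>1\<close> carries over
  (\<open>l1_complete\<close>, \<open>banach_space_on_isometric_image\<close>) as soon as the norm on the image is well
  defined, that is, as soon as a matrix determines its family.

  Two uniqueness facts make this work. First, an absolutely convergent expansion on the circle
  determines its coefficients (\<open>wiener_expansion_unique\<close>), so that Wiener functions and absolutely
  summable coefficient families correspond to each other. Second, the two summands of a
  quasi-Toeplitz matrix are determined by their sum (\<open>qt_matrix_eq_zero_imp\<close>): along a diagonal the
  Toeplitz part is constant, whereas the entries of a summable matrix are summable, and the only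
  constant sequence that is summable is zero.\<close>

section \<open>Uniqueness of Wiener coefficients\<close>

text \<open>Averaging over the \<open>N\<close>-th roots of unity is a discrete substitute for the Fourier
  integral: it isolates the frequency \<open>n\<close> among all frequencies closer than \<open>N\<close> to it, because the
  remaining ones give a vanishing geometric sum.\<close>

lemma sum_roots_of_unity_powi:
  fixes n i :: int
  assumes "N > 0" "\<bar>i - n\<bar> < int N"
  defines "w \<equiv> cis (2 * pi / real N)"
  shows "(\<Sum>k<N. (w ^ k) powi (i - n)) = (if i = n then of_nat N else 0)"
proof (cases "i = n")
  case False
  define v where "v = w powi (i - n)"
  have w_pow: "w powi m = cis (of_int m * (2 * pi / real N))" for m
    unfolding w_def by (simp add: cis_power_int)
  have "v ^ N = 1"
  proof -
    have "v ^ N = cis (real N * (of_int (i - n) * (2 * pi / real N)))"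
      unfolding v_def w_pow by (rule Complex.DeMoivre)
    also have "real N * (of_int (i - n) * (2 * pi / real N)) = 2 * pi * of_int (i - n)"
      using \<open>N > 0\<close> by simp
    finally show ?thesis by (simp add: cis_multiple_2pi)
  qed
  moreover have "v \<noteq> 1"
  proof
    assume "v = 1"
    then have "cos (of_int (i - n) * (2 * pi / real N)) = 1"
      unfolding v_def w_pow by (simp add: complex_eq_iff)
    then obtain m :: int where m: "of_int (i - n) * (2 * pi / real N) = of_int m * 2 * pi"
      using cos_one_2pi_int by blast
    then have "real_of_int (i - n) = of_int m * real N"
    proof -
      have "of_int (i - n) = (of_int (i - n) * (2 * pi / real N)) * (real N / (2 * pi))"
        using \<open>N > 0\<close> by simp
      also have "\<dots> = of_int m * real N" unfolding m by simp
      finally show ?thesis .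
    qed
    then have "i - n = m * int N"
      by (metis of_int_eq_iff of_int_mult of_int_of_nat_eq)
    then have "int N dvd i - n" by simp
    then show False using dvd_imp_le_int[of "i - n" "int N"] False assms(2) by simp
  qed
  ultimately have "(\<Sum>k<N. v ^ k) = 0"
    by (simp add: geometric_sum)
  moreover have "(w ^ k) powi (i - n) = v ^ k" for k
    unfolding v_def power_int_power power_int_power' by (simp only: mult.commute)
  ultimately show ?thesis using False by simp
qed simp

lemma has_sum_finite_sum:
  fixes f :: "'k \<Rightarrow> 'i \<Rightarrow> 'b::topological_comm_monoid_add"
  assumes "\<And>k. k \<in> K \<Longrightarrow> (f k has_sum s k) A"
  shows "((\<lambda>i. \<Sum>k\<in>K. f k i) has_sum (\<Sum>k\<in>K. s k)) A"
  using assms by (induction K rule: infinite_finite_induct) (auto intro: has_sum_add)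

text \<open>Averaging \<open>z powi (- n)\<close> times the expansion over the \<open>N\<close>-th roots of unity weights each
  coefficient with a number of modulus at most 1, which is 1 at \<open>n\<close> and 0 at every other index near
  \<open>n\<close>. If the expansion represents zero, then \<open>e n\<close> is bounded by the tail of the absolute series
  away from \<open>n\<close>, which is arbitrarily small for large \<open>N\<close>.\<close>

lemma wiener_expansion_of_zero:
  assumes sum: "(\<lambda>i. cmod (e i)) summable_on UNIV"
    and zero: "\<And>z. z \<in> unit_circle \<Longrightarrow> ((\<lambda>i. e i * z powi i) has_sum 0) UNIV"
  shows "e n = 0"
proof -
  have "cmod (e n) \<le> \<epsilon>" if "\<epsilon> > 0" for \<epsilon>
  proof -
    obtain S where S: "finite S" "dist (\<Sum>i\<in>S. cmod (e i)) (\<Sum>\<^sub>\<infinity>i. cmod (e i)) \<le> \<epsilon>"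
      using infsum_finite_approximation[OF sum \<open>\<epsilon> > 0\<close>] by auto
    \<comment> \<open>The increment makes every distance from \<open>n\<close> to a point of \<open>S\<close> strictly smaller than \<open>N\<close>.\<close>
    define N where "N = nat (Max ((\<lambda>i. \<bar>i - n\<bar>) ` insert n S)) + 1"
    have N: "\<bar>i - n\<bar> < int N" if "i \<in> insert n S" for i
    proof -
      have "\<bar>i - n\<bar> \<le> Max ((\<lambda>i. \<bar>i - n\<bar>) ` insert n S)"
        by (rule Max_ge) (use S that in auto)
      then show ?thesis unfolding N_def by linarith
    qed
    have "N > 0" by (simp add: N_def)
    define w where "w = cis (2 * pi / real N)"
    \<comment> \<open>The weight that the average attaches to the coefficient of index \<open>i\<close>.\<close>
    define g where "g i = (\<Sum>k<N. (w ^ k) powi (i - n)) / of_nat N" for i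
    have wnz: "w ^ k \<noteq> 0" for k by (simp add: w_def)
    have wk: "w ^ k \<in> unit_circle" for k by (simp add: w_def norm_power)
    have g_near: "g i = (if i = n then 1 else 0)" if "i \<in> insert n S" for i
      unfolding g_def w_def sum_roots_of_unity_powi[OF \<open>N > 0\<close> N[OF that]]
      using \<open>N > 0\<close> by simp
    have g_le: "cmod (g i) \<le> 1" for i
    proof -
      have "cmod (\<Sum>k<N. (w ^ k) powi (i - n)) \<le> (\<Sum>k<N. 1)"
        by (rule sum_norm_le) (simp add: w_def norm_power_int norm_power)
      then show ?thesis using \<open>N > 0\<close> by (simp add: g_def norm_divide)
    qed
    have "((\<lambda>i. (1 / of_nat N) * (\<Sum>k<N. (w ^ k) powi (- n) * (e i * (w ^ k) powi i))) has_sum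
        (1 / of_nat N) * (\<Sum>k<N. (w ^ k) powi (- n) * 0)) UNIV"
      by (intro has_sum_cmult_right has_sum_finite_sum zero wk)
    moreover have "(1 / of_nat N) * (\<Sum>k<N. (w ^ k) powi (- n) * (e i * (w ^ k) powi i)) = e i * g i" for i
      unfolding g_def power_int_diff[OF disjI1[OF wnz]] power_int_minus
      by (simp add: sum_distrib_left sum_divide_distrib field_simps)
    ultimately have avg: "((\<lambda>i. e i * g i) has_sum 0) UNIV" by simp
    let ?R = "UNIV - insert n S"
    have "((\<lambda>i. e i * g i) has_sum (0 - (\<Sum>i\<in>insert n S. e i * g i))) ?R"
      by (rule has_sum_Diff[OF avg has_sum_finite]) (use S in auto)
    moreover have "(\<Sum>i\<in>insert n S. e i * g i) = (\<Sum>i\<in>insert n S. if i = n then e i else 0)"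
      by (rule sum.cong) (simp_all add: g_near)
    ultimately have tail: "((\<lambda>i. e i * g i) has_sum - e n) ?R"
      using S by (simp add: sum.delta)
    have sR: "(\<lambda>i. cmod (e i)) summable_on A" for A
      by (rule summable_on_subset_banach[OF sum]) simp
    have le: "cmod (e i * g i) \<le> cmod (e i)" for i
      using g_le[of i] by (simp add: norm_mult mult_left_le)
    have "cmod (e n) \<le> (\<Sum>\<^sub>\<infinity>i\<in>?R. cmod (e i))"
      using norm_infsum_le[OF tail has_sum_infsum[OF sR]] le by simp
    also have "\<dots> \<le> (\<Sum>\<^sub>\<infinity>i\<in>UNIV - S. cmod (e i))"
      by (rule infsum_mono_neutral[OF sR sR]) auto
    also have "\<dots> = (\<Sum>\<^sub>\<infinity>i. cmod (e i)) - (\<Sum>i\<in>S. cmod (e i))"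
      using infsum_Diff[OF sum sR, of S] S by simp
    also have "\<dots> \<le> \<epsilon>" using S by (simp add: dist_real_def)
    finally show ?thesis .
  qed
  then have "cmod (e n) \<le> 0" by (rule field_le_epsilon[of _ 0, simplified])
  then show ?thesis by simp
qed

lemma norm_diff_summable_on:
  fixes f g :: "'i \<Rightarrow> 'b::real_normed_vector"
  assumes "(\<lambda>i. norm (f i)) summable_on A" "(\<lambda>i. norm (g i)) summable_on A"
  shows "(\<lambda>i. norm (f i - g i)) summable_on A"
  by (rule Infinite_Sum.abs_summable_on_comparison_test'[OF summable_on_add[OF assms]])
    (rule norm_triangle_ineq4)

lemma wiener_expansion_unique:
  assumes "is_wiener_expansion a c" "is_wiener_expansion a d"
  shows "c = d"
proof
  fix n
  have "c n - d n = 0"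
  proof (rule wiener_expansion_of_zero[of "\<lambda>i. c i - d i"])
    show "(\<lambda>i. cmod (c i - d i)) summable_on UNIV"
      using assms by (intro norm_diff_summable_on) (auto simp: is_wiener_expansion_def)
    fix z :: complex assume "z \<in> unit_circle"
    then show "((\<lambda>i. (c i - d i) * z powi i) has_sum 0) UNIV"
      using has_sum_add[of "\<lambda>i. c i * z powi i" UNIV "a z" "\<lambda>i. - (d i * z powi i)" "- a z"] assms
      by (simp add: is_wiener_expansion_def has_sum_uminus left_diff_distrib)
  qed
  then show "c n = d n" by simp
qed

lemma wiener_coeff_eqI: "is_wiener_expansion a c \<Longrightarrow> wiener_coeff a = c"
  unfolding wiener_coeff_def by (rule the_equality) (auto intro: wiener_expansion_unique)

text \<open>With uniqueness this identifies the Wiener class with the absolutely summable families on the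
  integers; in particular every such family arises, because absolute convergence on the circle
  defines a function there.\<close>

lemma wiener_coeff_image:
  "wiener_coeff ` wiener = {c. (\<lambda>i. cmod (c i)) summable_on UNIV}"
proof (intro equalityI subsetI)
  fix c assume "c \<in> {c. (\<lambda>i. cmod (c i)) summable_on (UNIV :: int set)}"
  then have c: "(\<lambda>i. cmod (c i)) summable_on UNIV" by simp
  define a where "a = restrict (\<lambda>z. \<Sum>\<^sub>\<infinity>i. c i * z powi i) unit_circle"
  have "is_wiener_expansion a c"
    unfolding is_wiener_expansion_def
  proof (intro conjI ballI c)
    fix z :: complex assume z: "z \<in> unit_circle"
    have "(\<lambda>i. c i * z powi i) summable_on UNIV"
      by (rule abs_summable_summable) (use c z in \<open>simp add: norm_mult norm_power_int\<close>)
    then show "((\<lambda>i. c i * z powi i) has_sum a z) UNIV"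
      using z by (simp add: a_def)
  qed
  moreover have "a \<in> extensional unit_circle" by (simp add: a_def)
  ultimately show "c \<in> wiener_coeff ` wiener"
    using wiener_coeff_eqI unfolding wiener_def by blast
next
  fix c assume "c \<in> wiener_coeff ` wiener"
  then obtain a where "is_wiener_expansion a c"
    using wiener_coeff_eqI unfolding wiener_def by blast
  then show "c \<in> {c. (\<lambda>i. cmod (c i)) summable_on UNIV}"
    by (simp add: is_wiener_expansion_def)
qed

section \<open>The space of absolutely summable families\<close>

definition abs_summable_families :: "('i \<Rightarrow> complex) set" where
  "abs_summable_families = {g. (\<lambda>x. cmod (g x)) summable_on UNIV}"

definition l1_norm :: "('i \<Rightarrow> complex) \<Rightarrow> real" where
  "l1_norm g = (\<Sum>\<^sub>\<infinity>x. cmod (g x))"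

definition family_scale :: "complex \<Rightarrow> ('i \<Rightarrow> complex) \<Rightarrow> 'i \<Rightarrow> complex" where
  "family_scale c g = (\<lambda>x. c * g x)"

lemma finite_sum_le_l1_norm:
  assumes "g \<in> abs_summable_families" "finite S"
  shows "(\<Sum>x\<in>S. cmod (g x)) \<le> l1_norm g"
  unfolding l1_norm_def
  by (rule finite_sum_le_infsum) (use assms in \<open>auto simp: abs_summable_families_def\<close>)

text \<open>Finite partial sums, unlike infinite ones, can be estimated before summability is known, and
  non-strict bounds on them survive pointwise limits.\<close>

lemma l1_of_bounded_finite_sums:
  assumes "\<And>S. finite S \<Longrightarrow> (\<Sum>x\<in>S. cmod (g x)) \<le> C"
  shows "g \<in> abs_summable_families" "l1_norm g \<le> C"
proof -
  have "bdd_above (sum (\<lambda>x. cmod (g x)) ` {S. S \<subseteq> UNIV \<and> finite S})"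
    by (rule bdd_aboveI2[where M = C]) (use assms in auto)
  then have s: "(\<lambda>x. cmod (g x)) summable_on UNIV"
    by (intro nonneg_bdd_above_summable_on) auto
  then show "g \<in> abs_summable_families" by (simp add: abs_summable_families_def)
  show "l1_norm g \<le> C"
    unfolding l1_norm_def by (rule infsum_le_finite_sums[OF s]) (use assms in auto)
qed

lemma vector_space_family_scale: "vector_space family_scale"
  by unfold_locales (auto simp: family_scale_def algebra_simps)

lemma complex_normed_space_on_l1:
  "complex_normed_space_on (abs_summable_families :: ('i \<Rightarrow> complex) set) family_scale l1_norm"
proof -
  let ?V = "abs_summable_families :: ('i \<Rightarrow> complex) set"
  interpret vector_space "family_scale :: _ \<Rightarrow> ('i \<Rightarrow> complex) \<Rightarrow> _"
    by (rule vector_space_family_scale)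
  have add: "x + y \<in> ?V" "l1_norm (x + y) \<le> l1_norm x + l1_norm y"
    if "x \<in> ?V" "y \<in> ?V" for x y
  proof -
    have "(\<Sum>s\<in>S. cmod ((x + y) s)) \<le> l1_norm x + l1_norm y" if "finite S" for S
    proof -
      have "(\<Sum>s\<in>S. cmod ((x + y) s)) \<le> (\<Sum>s\<in>S. cmod (x s) + cmod (y s))"
        by (rule sum_mono) (simp add: norm_triangle_ineq)
      also have "\<dots> \<le> l1_norm x + l1_norm y"
        unfolding sum.distrib
        by (intro add_mono finite_sum_le_l1_norm \<open>x \<in> ?V\<close> \<open>y \<in> ?V\<close> that)
      finally show ?thesis .
    qed
    note bounded = l1_of_bounded_finite_sums[OF this]
    show "x + y \<in> ?V" by (rule bounded)
    show "l1_norm (x + y) \<le> l1_norm x + l1_norm y" by (rule bounded)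
  qed
  have scale: "family_scale c x \<in> ?V" "l1_norm (family_scale c x) = cmod c * l1_norm x"
    if "x \<in> ?V" for c x
  proof -
    have "(\<lambda>s. cmod (x s)) summable_on UNIV"
      using that by (simp add: abs_summable_families_def)
    from has_sum_cmult_right[OF has_sum_infsum[OF this], of "cmod c"]
    have "((\<lambda>s. cmod (family_scale c x s)) has_sum cmod c * l1_norm x) UNIV"
      by (simp add: family_scale_def norm_mult l1_norm_def)
    then show "family_scale c x \<in> ?V" "l1_norm (family_scale c x) = cmod c * l1_norm x"
      by (auto simp: abs_summable_families_def l1_norm_def summable_on_def infsumI)
  qed
  have zero: "(0 :: 'i \<Rightarrow> complex) \<in> ?V" "l1_norm (0 :: 'i \<Rightarrow> complex) = 0"
    by (simp_all add: abs_summable_families_def l1_norm_def)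
  have definite: "x = 0" if "x \<in> ?V" "l1_norm x = 0" for x
  proof
    fix s show "x s = 0 s"
    proof -
      have "(\<Sum>s\<in>{s}. cmod (x s)) \<le> 0"
        unfolding that(2)[symmetric] by (rule finite_sum_le_l1_norm[OF that(1)]) simp
      then show ?thesis by simp
    qed
  qed
  have nonneg: "0 \<le> l1_norm x" for x :: "'i \<Rightarrow> complex"
    unfolding l1_norm_def by (rule infsum_nonneg) simp
  have sub: "subspace ?V" by (intro subspaceI zero add scale)
  have zero_iff: "\<forall>x\<in>?V. l1_norm x = 0 \<longleftrightarrow> x = 0"
    using definite zero(2) by metis
  show ?thesis
    unfolding complex_normed_space_on_def
    by (intro conjI sub zero_iff ballI allI vector_space_family_scale nonneg add(2) scale(2))
qed

lemma abs_summable_families_diff: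
  assumes "x \<in> abs_summable_families" "y \<in> abs_summable_families"
  shows "x - y \<in> abs_summable_families"
  using assms norm_diff_summable_on[of x UNIV y] by (simp add: abs_summable_families_def)

text \<open>A Cauchy sequence of families converges pointwise. The Cauchy estimate restricted to a finite
  set of indices survives the pointwise limit, and the resulting bounds on finite partial sums are
  uniform, so they give convergence in norm as well as summability of the limit. The conclusion is
  phrased through norms instead of a metric topology, which is the form that transfers along an
  isometry.\<close>

lemma l1_complete:
  fixes g :: "nat \<Rightarrow> 'i \<Rightarrow> complex"
  assumes g: "\<And>n. g n \<in> abs_summable_families"
    and cauchy: "\<And>\<epsilon>. \<epsilon> > 0 \<Longrightarrow> \<exists>M. \<forall>m\<ge>M. \<forall>n\<ge>M. l1_norm (g m - g n) < \<epsilon>"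
  shows "\<exists>h\<in>abs_summable_families. \<forall>\<epsilon>>0. \<exists>M. \<forall>n\<ge>M. l1_norm (g n - h) < \<epsilon>"
proof -
  note diff = abs_summable_families_diff
  have "Cauchy (\<lambda>n. g n x)" for x
  proof (rule metric_CauchyI)
    fix \<epsilon> :: real assume "\<epsilon> > 0"
    then obtain M where M: "\<And>m n. m \<ge> M \<Longrightarrow> n \<ge> M \<Longrightarrow> l1_norm (g m - g n) < \<epsilon>"
      using cauchy by blast
    have "dist (g m x) (g n x) < \<epsilon>" if "m \<ge> M" "n \<ge> M" for m n
      using M[OF that] finite_sum_le_l1_norm[OF diff[OF g g], of "{x}" m n]
      by (simp add: dist_norm)
    then show "\<exists>M. \<forall>m\<ge>M. \<forall>n\<ge>M. dist (g m x) (g n x) < \<epsilon>" by blast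
  qed
  then obtain h where h: "\<And>x. (\<lambda>n. g n x) \<longlonglongrightarrow> h x"
    unfolding Cauchy_convergent_iff convergent_def by metis
  have close: "\<exists>M. \<forall>n\<ge>M. g n - h \<in> abs_summable_families \<and> l1_norm (g n - h) < \<epsilon>"
    if "\<epsilon> > 0" for \<epsilon>
  proof -
    obtain M where M: "\<And>m n. m \<ge> M \<Longrightarrow> n \<ge> M \<Longrightarrow> l1_norm (g m - g n) < \<epsilon> / 2"
      using cauchy[OF half_gt_zero[OF \<open>\<epsilon> > 0\<close>]] by blast
    have "g n - h \<in> abs_summable_families \<and> l1_norm (g n - h) < \<epsilon>" if "n \<ge> M" for n
    proof -
      have bound: "(\<Sum>x\<in>S. cmod ((g n - h) x)) \<le> \<epsilon> / 2" if "finite S" for S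
      proof (rule Lim_bounded)
        show "(\<lambda>m. \<Sum>x\<in>S. cmod (g n x - g m x)) \<longlonglongrightarrow> (\<Sum>x\<in>S. cmod ((g n - h) x))"
          by (auto intro!: tendsto_intros h)
        show "\<forall>m\<ge>M. (\<Sum>x\<in>S. cmod (g n x - g m x)) \<le> \<epsilon> / 2"
        proof (intro allI impI)
          fix m assume "m \<ge> M"
          show "(\<Sum>x\<in>S. cmod (g n x - g m x)) \<le> \<epsilon> / 2"
            using finite_sum_le_l1_norm[OF diff[OF g g] that, of n m] M[OF \<open>n \<ge> M\<close> \<open>m \<ge> M\<close>]
            by simp
        qed
      qed
      show ?thesis
        using l1_of_bounded_finite_sums[where g = "g n - h", OF bound] \<open>\<epsilon> > 0\<close>
        by fastforce
    qed
    then show ?thesis by blast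
  qed
  obtain n where "g n - h \<in> abs_summable_families"
    using close[of 1] by auto
  \<comment> \<open>The limit is the difference of the summable families \<open>g n\<close> and \<open>g n - h\<close>.\<close>
  from diff[OF g this, of n] have "h \<in> abs_summable_families" by simp
  with close show ?thesis by blast
qed

section \<open>Banach spaces from isometric linear images\<close>

lemma normed_space_on_metric:
  assumes "complex_normed_space_on V smul N"
  shows "Metric_space V (norm_dist_on V N)"
proof -
  interpret vector_space smul
    using assms by (simp add: complex_normed_space_on_def)
  have sub: "subspace V" using assms by (simp add: complex_normed_space_on_def)
  note diff = subspace_diff[OF sub]
  show ?thesis
  proof
    fix x y z
    show "0 \<le> norm_dist_on V N x y"
      using assms diff by (simp add: norm_dist_on_def complex_normed_space_on_def)
    show "norm_dist_on V N x y = norm_dist_on V N y x"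
    proof -
      have "N (y - x) = N (x - y)" if "x \<in> V" "y \<in> V"
      proof -
        have "N (smul (- 1) (x - y)) = cmod (- 1) * N (x - y)"
          using assms diff[OF that] unfolding complex_normed_space_on_def by blast
        then show ?thesis by simp
      qed
      then show ?thesis by (simp add: norm_dist_on_def)
    qed
    show "norm_dist_on V N x y = 0 \<longleftrightarrow> x = y" if "x \<in> V" "y \<in> V"
      using assms diff[OF that] that by (simp add: norm_dist_on_def complex_normed_space_on_def)
    show "norm_dist_on V N x z \<le> norm_dist_on V N x y + norm_dist_on V N y z"
      if "x \<in> V" "y \<in> V" "z \<in> V"
    proof -
      have "N ((x - y) + (y - z)) \<le> N (x - y) + N (y - z)"
        using assms diff[OF that(1,2)] diff[OF that(2,3)]
        unfolding complex_normed_space_on_def by blast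
      then show ?thesis using that by (simp add: norm_dist_on_def)
    qed
  qed
qed

text \<open>The norm on the image is only known through \<open>T\<close>. The norm axioms and Cauchy sequences are
  therefore pulled back to \<open>V\<close>, where limits exist, and the limits are pushed forward.\<close>

lemma banach_space_on_isometric_image:
  fixes T :: "'v::ab_group_add \<Rightarrow> 'w::ab_group_add"
  assumes V: "complex_normed_space_on V smul N"
    and complete: "\<And>g. (\<And>n::nat. g n \<in> V) \<Longrightarrow>
      (\<And>\<epsilon>. \<epsilon> > 0 \<Longrightarrow> \<exists>M. \<forall>m\<ge>M. \<forall>n\<ge>M. N (g m - g n) < \<epsilon>) \<Longrightarrow>
      \<exists>h\<in>V. \<forall>\<epsilon>>0. \<exists>M. \<forall>n\<ge>M. N (g n - h) < \<epsilon>"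
    and W: "vector_space smul'"
    and add: "\<And>x y. T (x + y) = T x + T y"
    and scale: "\<And>c x. T (smul c x) = smul' c (T x)"
    and inj: "\<And>x. x \<in> V \<Longrightarrow> T x = 0 \<Longrightarrow> x = 0"
    and isometric: "\<And>x. x \<in> V \<Longrightarrow> N' (T x) = N x"
  shows "complex_banach_space_on (T ` V) smul' N'"
proof -
  interpret V: vector_space smul
    using V by (simp add: complex_normed_space_on_def)
  interpret W: vector_space smul' by (rule W)
  have sub: "V.subspace V" using V by (simp add: complex_normed_space_on_def)
  have zero: "T 0 = 0" using add[of 0 0] by simp
  have diff: "T (x - y) = T x - T y" for x y
    using add[of "x - y" y] by (simp add: algebra_simps)
  have "W.subspace (T ` V)"
    unfolding W.subspace_def using sub zero
    by (auto simp: V.subspace_def simp flip: add scale)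
  then have normed: "complex_normed_space_on (T ` V) smul' N'"
    using V W inj zero unfolding complex_normed_space_on_def
    by (auto simp: isometric V.subspace_add[OF sub] V.subspace_scale[OF sub]
        simp flip: add scale)
  let ?d = "norm_dist_on (T ` V) N'"
  interpret M: Metric_space "T ` V" ?d
    by (rule normed_space_on_metric[OF normed])
  have d: "?d (T x) (T y) = N (x - y)" if "x \<in> V" "y \<in> V" for x y
    using that isometric[OF V.subspace_diff[OF sub that]]
    by (simp add: norm_dist_on_def diff)
  have "M.mcomplete"
    unfolding M.mcomplete_def
  proof (intro allI impI)
    fix \<sigma> assume \<sigma>: "M.MCauchy \<sigma>"
    then have "\<forall>n. \<exists>x\<in>V. \<sigma> n = T x" unfolding M.MCauchy_def by blast
    then obtain g where g: "\<And>n. g n \<in> V" "\<And>n. \<sigma> n = T (g n)" by metis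
    have "\<exists>M. \<forall>m\<ge>M. \<forall>n\<ge>M. N (g m - g n) < \<epsilon>" if "\<epsilon> > 0" for \<epsilon>
    proof -
      obtain M where "\<And>m n. m \<ge> M \<Longrightarrow> n \<ge> M \<Longrightarrow> ?d (\<sigma> m) (\<sigma> n) < \<epsilon>"
        using \<sigma> \<open>\<epsilon> > 0\<close> unfolding M.MCauchy_def by blast
      then have "\<forall>m\<ge>M. \<forall>n\<ge>M. N (g m - g n) < \<epsilon>"
        by (simp add: g d)
      then show ?thesis by blast
    qed
    from complete[OF g(1) this] obtain h where h: "h \<in> V"
      "\<And>\<epsilon>. \<epsilon> > 0 \<Longrightarrow> \<exists>M. \<forall>n\<ge>M. N (g n - h) < \<epsilon>" by blast
    have "limitin M.mtopology \<sigma> (T h) sequentially"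
      unfolding M.limitin_metric eventually_sequentially
      using h g by (auto simp: d)
    then show "\<exists>x. limitin M.mtopology \<sigma> x sequentially" by blast
  qed
  with normed M.Metric_space_axioms show ?thesis
    by (simp add: complex_banach_space_on_def)
qed

section \<open>Quasi-Toeplitz matrices as an isometric image\<close>

text \<open>The left summand of the index type carries the coefficients of the symbol, the right one the
  entries of the summable correction.\<close>

definition qt_matrix :: "(int + nat \<times> nat \<Rightarrow> complex) \<Rightarrow> inf_matrix" where
  "qt_matrix g = (\<lambda>i j. g (Inl (int j - int i)) + g (Inr (i, j)))"

text \<open>If the matrix vanishes, then along the diagonal with offset \<open>n\<close> the entries of the correction
  all equal the negated coefficient of index \<open>n\<close>. They are summable, hence zero, and then so is the
  correction. This is the uniqueness of the decomposition of a quasi-Toeplitz matrix.\<close>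

lemma qt_matrix_eq_zero_imp:
  assumes g: "g \<in> abs_summable_families" and zero: "qt_matrix g = 0"
  shows "g = 0"
proof -
  have sum: "(\<lambda>x. cmod (g x)) summable_on UNIV"
    using g by (simp add: abs_summable_families_def)
  have ent: "g (Inl (int j - int i)) + g (Inr (i, j)) = 0" for i j
    using zero by (simp add: qt_matrix_def fun_eq_iff)
  have Inl0: "g (Inl n) = 0" for n
  proof -
    \<comment> \<open>The diagonal with offset \<open>n\<close>, started at the border of the matrix: one of the two shifts
      \<open>nat (- n)\<close> and \<open>nat n\<close> is always 0.\<close>
    define p :: "nat \<Rightarrow> int + nat \<times> nat"
      where "p k = Inr (k + nat (- n), k + nat n)" for k
    have "inj p" by (auto simp: inj_def p_def)
    have "(\<lambda>x. cmod (g x)) summable_on range p"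
      by (rule summable_on_subset_banach[OF sum]) simp
    then have "(\<lambda>k. cmod (g (p k))) summable_on UNIV"
      using summable_on_reindex[OF \<open>inj p\<close>, of "\<lambda>x. cmod (g x)"] by (simp add: o_def)
    moreover have "cmod (g (p k)) = cmod (g (Inl n))" for k
    proof -
      have "int (k + nat n) - int (k + nat (- n)) = n" by simp
      with ent[of "k + nat n" "k + nat (- n)"] show ?thesis
        by (simp add: p_def eq_neg_iff_add_eq_0[symmetric])
    qed
    ultimately have "(\<lambda>k::nat. cmod (g (Inl n))) summable_on UNIV" by simp
    then show ?thesis
      using infsum_diverge_constant[of UNIV "cmod (g (Inl n))"] by auto
  qed
  show ?thesis
  proof
    fix x
    have "g (Inr (i, j)) = 0" for i j using ent[of j i] by (simp add: Inl0)
    then show "g x = 0 x" by (cases x) (auto simp: Inl0)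
  qed
qed

lemma qt_matrix_decomposition:
  assumes "(\<lambda>i. cmod (c i)) summable_on UNIV" "E \<in> summable_matrices"
  defines "g \<equiv> case_sum c (\<lambda>(i, j). E i j)"
  shows "g \<in> abs_summable_families"
    and "l1_norm g = (\<Sum>\<^sub>\<infinity>i. cmod (c i)) + summable_matrix_norm E"
    and "qt_matrix g = (\<lambda>i j. c (int j - int i)) + E"
proof -
  have "((\<lambda>x. cmod (g x)) has_sum (\<Sum>\<^sub>\<infinity>i. cmod (c i))) (range Inl)"
    using has_sum_infsum[OF assms(1)]
    by (subst has_sum_reindex) (auto simp: g_def o_def)
  moreover have "((\<lambda>x. cmod (g x)) has_sum summable_matrix_norm E) (range Inr)"
    using has_sum_infsum[of "\<lambda>(i, j). cmod (E i j)" UNIV] assms(2)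
    by (subst has_sum_reindex)
      (simp_all add: g_def o_def summable_matrices_def summable_matrix_norm_def case_prod_unfold)
  ultimately have "((\<lambda>x. cmod (g x)) has_sum
      ((\<Sum>\<^sub>\<infinity>i. cmod (c i)) + summable_matrix_norm E)) (range Inl \<union> range Inr)"
    by (rule has_sum_Un_disjoint) auto
  then have *: "((\<lambda>x. cmod (g x)) has_sum
      ((\<Sum>\<^sub>\<infinity>i. cmod (c i)) + summable_matrix_norm E)) UNIV"
    by (simp add: UNIV_sum)
  show "g \<in> abs_summable_families"
    using * by (auto simp: abs_summable_families_def summable_on_def)
  show "l1_norm g = (\<Sum>\<^sub>\<infinity>i. cmod (c i)) + summable_matrix_norm E"
    using * by (simp add: l1_norm_def infsumI)
  show "qt_matrix g = (\<lambda>i j. c (int j - int i)) + E"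
    by (simp add: qt_matrix_def g_def fun_eq_iff)
qed

lemma qt_matrix_inj:
  assumes "g \<in> abs_summable_families" "h \<in> abs_summable_families" "qt_matrix g = qt_matrix h"
  shows "g = h"
proof -
  have "g - h \<in> abs_summable_families"
    using assms(1,2) by (rule abs_summable_families_diff)
  moreover have "qt_matrix (g - h) = 0"
    using assms(3) by (simp add: qt_matrix_def fun_eq_iff algebra_simps)
  ultimately show ?thesis using qt_matrix_eq_zero_imp by force
qed

lemma QT_member_family:
  assumes "a \<in> wiener" "E \<in> summable_matrices"
  obtains g where "g \<in> abs_summable_families" "qt_matrix g = toeplitz a + E"
    "l1_norm g = wiener_norm a + summable_matrix_norm E"
proof -
  have "(\<lambda>i. cmod (wiener_coeff a i)) summable_on UNIV"
    using assms(1) wiener_coeff_image by blast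
  from qt_matrix_decomposition[OF this assms(2)] show ?thesis
    by (intro that) (auto simp: toeplitz_def wiener_norm_def)
qed

lemma family_QT_member:
  assumes g: "g \<in> abs_summable_families"
  obtains a E where "a \<in> wiener" "E \<in> summable_matrices" "qt_matrix g = toeplitz a + E"
    "l1_norm g = wiener_norm a + summable_matrix_norm E"
proof -
  define E where "E i j = g (Inr (i, j))" for i j
  have sum: "(\<lambda>x. cmod (g x)) summable_on A" for A
    using g by (auto simp: abs_summable_families_def intro: summable_on_subset_banach)
  have c: "(\<lambda>i. cmod (g (Inl i))) summable_on UNIV"
    using summable_on_reindex[of Inl UNIV "\<lambda>x. cmod (g x)"] sum by (simp add: o_def)
  have E: "E \<in> summable_matrices"
    using summable_on_reindex[of Inr UNIV "\<lambda>x. cmod (g x)"] sum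
    by (simp add: o_def summable_matrices_def E_def case_prod_unfold)
  have "(\<lambda>i. g (Inl i)) \<in> wiener_coeff ` wiener"
    unfolding wiener_coeff_image using c by simp
  then obtain a where a: "a \<in> wiener" "wiener_coeff a = (\<lambda>i. g (Inl i))"
    by (metis imageE)
  have "case_sum (\<lambda>i. g (Inl i)) (\<lambda>(i, j). E i j) = g"
    by (auto simp: fun_eq_iff E_def split: sum.split)
  with qt_matrix_decomposition[OF c E] a E show ?thesis
    by (intro that) (auto simp: toeplitz_def wiener_norm_def)
qed

lemma QT_eq_image: "QT = qt_matrix ` abs_summable_families"
proof (intro equalityI subsetI)
  fix A assume "A \<in> QT"
  then obtain a E where aE: "a \<in> wiener" "E \<in> summable_matrices" "A = toeplitz a + E"
    unfolding QT_def by blast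
  obtain g where "g \<in> abs_summable_families" "qt_matrix g = toeplitz a + E"
    using QT_member_family[OF aE(1,2)] .
  then show "A \<in> qt_matrix ` abs_summable_families"
    using aE(3) by (metis image_eqI)
next
  fix A assume "A \<in> qt_matrix ` abs_summable_families"
  then obtain g where g: "g \<in> abs_summable_families" "A = qt_matrix g" by blast
  obtain a E where "a \<in> wiener" "E \<in> summable_matrices" "qt_matrix g = toeplitz a + E"
    using family_QT_member[OF g(1)] .
  then show "A \<in> QT"
    unfolding QT_def g(2) by blast
qed

text \<open>By injectivity of \<open>qt_matrix\<close> every decomposition of the matrix comes from the same family, so
  the definite description in the quasi-Toeplitz norm has exactly one candidate.\<close>

lemma QT_norm_qt_matrix:
  assumes g: "g \<in> abs_summable_families"
  shows "QT_norm (qt_matrix g) = l1_norm g"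
  unfolding QT_norm_def
proof (rule the_equality)
  show "\<exists>a\<in>wiener. \<exists>E\<in>summable_matrices.
      qt_matrix g = toeplitz a + E \<and> l1_norm g = wiener_norm a + summable_matrix_norm E"
    by (rule family_QT_member[OF g]) blast
next
  fix r
  assume "\<exists>a\<in>wiener. \<exists>E\<in>summable_matrices.
      qt_matrix g = toeplitz a + E \<and> r = wiener_norm a + summable_matrix_norm E"
  then obtain a E where aE: "a \<in> wiener" "E \<in> summable_matrices"
    "qt_matrix g = toeplitz a + E" "r = wiener_norm a + summable_matrix_norm E" by blast
  obtain h where h: "h \<in> abs_summable_families" "qt_matrix h = toeplitz a + E"
    "l1_norm h = wiener_norm a + summable_matrix_norm E"
    using QT_member_family[OF aE(1,2)] .
  have "g = h" using qt_matrix_inj[OF g h(1)] aE(3) h(2) by simp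
  then show "r = l1_norm g" using aE(4) h(3) by simp
qed

theorem lemma3p2:
  shows "complex_banach_space_on QT mat_scale QT_norm"
  unfolding QT_eq_image
proof (rule banach_space_on_isometric_image[OF complex_normed_space_on_l1])
  show "vector_space mat_scale"
    by unfold_locales (auto simp: mat_scale_def fun_eq_iff algebra_simps)
  show "qt_matrix (x + y) = qt_matrix x + qt_matrix y" for x y
    by (simp add: qt_matrix_def fun_eq_iff)
  show "qt_matrix (family_scale c x) = mat_scale c (qt_matrix x)" for c x
    by (simp add: qt_matrix_def mat_scale_def family_scale_def distrib_left)
qed (fact l1_complete qt_matrix_eq_zero_imp QT_norm_qt_matrix)+

end
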